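(* If a graph $H$ contains an induced cycle of length at least $5$, then the class of $H$-subdivisions does not have the induced Erdős–Pósa property.
   Context: All graphs are finite and simple. A subdivision of $H$ is a graph obtained from $H$ by repeatedly replacing an edge by a path of length $2$ through a new vertex. An induced subdivision of $H$ in $G$ is an induced subgraph of $G$ isomorphic to a subdivision of $H$. The class of $H$-subdivisions has the induced Erdős–Pósa property if there is a function $f:\mathbb N\to\mathbb R$ such that for every graph $G$ and every positive integer $k$, $G$ contains either $k$ pairwise vertex-disjoint induced subdivisions of $H$ or a set of at most $f(k)$ vertices meeting every induced subdivision of $H$. *)

theory Defs
  imports Complex_Main
begin

type_synonym 'a graph = "'a set \<times> 'a set set"

definition verts :: "'a graph \<Rightarrow> 'a set" where "verts G = fst G"
definition edges :: "'a graph \<Rightarrow> 'a set set" where "edges G = snd G"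

definition wf_graph :: "'a graph \<Rightarrow> bool" where
  "wf_graph G \<longleftrightarrow> finite (verts G) \<and> (\<forall>e\<in>edges G. e \<subseteq> verts G \<and> card e = 2)"

definition induced_subgraph :: "'a graph \<Rightarrow> 'a set \<Rightarrow> 'a graph" where
  "induced_subgraph G S = (S, {e \<in> edges G. e \<subseteq> S})"

definition graph_iso :: "'a graph \<Rightarrow> 'b graph \<Rightarrow> bool" where
  "graph_iso G H \<longleftrightarrow> (\<exists>f. bij_betw f (verts G) (verts H) \<and>
      (\<forall>x\<in>verts G. \<forall>y\<in>verts G. {x, y} \<in> edges G \<longleftrightarrow> {f x, f y} \<in> edges H))"

inductive subdivision_of :: "'a graph \<Rightarrow> ('a + nat) graph \<Rightarrow> bool" for H where
  base: "subdivision_of H (Inl ` verts H, (\<lambda>e. Inl ` e) ` edges H)"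
| step: "subdivision_of H (V, E) \<Longrightarrow> {x, y} \<in> E \<Longrightarrow> z \<notin> V \<Longrightarrow>
         subdivision_of H (insert z V, (E - {{x, y}}) \<union> {{x, z}, {z, y}})"

definition induced_subdivision :: "'a graph \<Rightarrow> 'b graph \<Rightarrow> 'b set \<Rightarrow> bool" where
  "induced_subdivision H G S \<longleftrightarrow> S \<subseteq> verts G \<and>
     (\<exists>H'. subdivision_of H H' \<and> graph_iso (induced_subgraph G S) H')"

text \<open>Induced Erdos-Posa property; "every graph G" ranges over finite graphs with
natural-number vertices (every finite graph is isomorphic to one).\<close>
definition induced_EP_property :: "'a graph \<Rightarrow> bool" where
  "induced_EP_property H \<longleftrightarrow> (\<exists>f :: nat \<Rightarrow> real. \<forall>(G :: nat graph) k. wf_graph G \<longrightarrow> k > 0 \<longrightarrow>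
      (\<exists>S :: nat \<Rightarrow> nat set. (\<forall>i<k. induced_subdivision H G (S i)) \<and>
          (\<forall>i<k. \<forall>j<k. i \<noteq> j \<longrightarrow> S i \<inter> S j = {}))
    \<or> (\<exists>X. X \<subseteq> verts G \<and> real (card X) \<le> f k \<and>
          (\<forall>S. induced_subdivision H G S \<longrightarrow> S \<inter> X \<noteq> {})))"

definition cycle_graph :: "nat \<Rightarrow> nat graph" where
  "cycle_graph n = ({..<n}, {{i, Suc i mod n} | i. i < n})"

definition has_induced_cycle_of_length :: "'a graph \<Rightarrow> nat \<Rightarrow> bool" where
  "has_induced_cycle_of_length H n \<longleftrightarrow>
     (\<exists>S \<subseteq> verts H. graph_iso (induced_subgraph H S) (cycle_graph n))"

end

theory Submission
  imports Defs "HOL-Library.Nat_Bijection"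
begin

text \<open>
  Let \<open>q\<close> be the number of edges of \<open>H\<close>, and subdivide every edge of \<open>H\<close> an odd, large number of
  times. Take \<open>n\<close> copies of this subdivision and let any two copies \<open>i \<noteq> j\<close> share one
  crossing vertex on each subdivided edge, so that crossing vertices are never adjacent within a
  copy. Finally join two vertices that lie in no common copy whenever they are not both crossing
  vertices. Every copy remains an induced subdivision of \<open>H\<close>, and since a vertex lies in at most
  two copies, fewer than \<open>n / 2\<close> vertices cannot meet all copies.

  In this graph every induced cycle of length at least five lies inside a single copy, hence it
  runs through one whole subdivided edge of that copy. Every induced subdivision of \<open>H\<close> contains such
  a cycle; among \<open>q + 1\<close> of them two run through the same edge of \<open>H\<close>, in copies \<open>i\<close> and \<open>j\<close>,
  and therefore both contain the crossing vertex of \<open>i\<close> and \<open>j\<close> on it, or share the whole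
  subdivided edge if \<open>i = j\<close>.
\<close>

section \<open>Hole sets in finite simple graphs\<close>

lemma wf_graph_subdivision:
  assumes "subdivision_of H K" "wf_graph H"
  shows "wf_graph K"
  using assms(1)
proof induction
  case base
  have "card (Inl ` e :: ('a + nat) set) = card e" for e :: "'a set"
    by (simp add: card_image)
  with assms(2) show ?case
    by (auto simp: wf_graph_def verts_def edges_def)
next
  case (step V E x y z)
  from step have "x \<in> V" "y \<in> V" by (auto simp: wf_graph_def verts_def edges_def)
  with step have "card {x, z} = 2" "card {z, y} = 2" by (auto simp: card_2_iff)
  with step \<open>x \<in> V\<close> \<open>y \<in> V\<close> show ?case
    by (auto simp: wf_graph_def verts_def edges_def)
qed

lemma wf_graph_edge:
  assumes "wf_graph G" "{u, v} \<in> edges G"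
  shows "u \<noteq> v" "u \<in> verts G" "v \<in> verts G"
  using assms by (auto simp: wf_graph_def card_2_iff)

definition nbrs :: "'a graph \<Rightarrow> 'a set \<Rightarrow> 'a \<Rightarrow> 'a set" where
  "nbrs G S v = {w \<in> S. {v, w} \<in> edges G}"

text \<open>A hole set induces a disjoint union of induced cycles of length at least five;
  connectedness is never needed.\<close>

definition hole_set :: "'a graph \<Rightarrow> 'a set \<Rightarrow> bool" where
  "hole_set G Z \<longleftrightarrow> Z \<noteq> {} \<and> Z \<subseteq> verts G
     \<and> (\<forall>p\<in>Z. \<exists>u v. u \<noteq> v \<and> nbrs G Z p = {u, v})
     \<and> (\<forall>x\<in>Z. \<forall>y\<in>Z. \<forall>z\<in>Z. {x, y} \<in> edges G \<longrightarrow> {y, z} \<in> edges G \<longrightarrow> {x, z} \<notin> edges G)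
     \<and> (\<forall>x\<in>Z. \<forall>y\<in>Z. \<forall>z\<in>Z. \<forall>w\<in>Z. x \<noteq> z \<longrightarrow> y \<noteq> w \<longrightarrow>
          {x, y} \<in> edges G \<longrightarrow> {y, z} \<in> edges G \<longrightarrow> {z, w} \<in> edges G \<longrightarrow> {w, x} \<notin> edges G)"

lemma hole_setI:
  assumes "Z \<noteq> {}" "Z \<subseteq> verts G"
    and "\<And>p. p \<in> Z \<Longrightarrow> \<exists>u v. u \<noteq> v \<and> nbrs G Z p = {u, v}"
    and "\<And>x y z. \<lbrakk>x \<in> Z; y \<in> Z; z \<in> Z; {x, y} \<in> edges G; {y, z} \<in> edges G\<rbrakk> \<Longrightarrow> {x, z} \<notin> edges G"
    and "\<And>x y z w. \<lbrakk>x \<in> Z; y \<in> Z; z \<in> Z; w \<in> Z; x \<noteq> z; y \<noteq> w;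
           {x, y} \<in> edges G; {y, z} \<in> edges G; {z, w} \<in> edges G\<rbrakk> \<Longrightarrow> {w, x} \<notin> edges G"
  shows "hole_set G Z"
  unfolding hole_set_def by (intro conjI ballI impI; rule assms; assumption)

lemma hole_setD:
  assumes "hole_set G Z"
  shows "Z \<noteq> {}" "Z \<subseteq> verts G"
    and "\<And>p. p \<in> Z \<Longrightarrow> \<exists>u v. u \<noteq> v \<and> nbrs G Z p = {u, v}"
    and "\<And>x y z. \<lbrakk>x \<in> Z; y \<in> Z; z \<in> Z; {x, y} \<in> edges G; {y, z} \<in> edges G\<rbrakk> \<Longrightarrow> {x, z} \<notin> edges G"
    and "\<And>x y z w. \<lbrakk>x \<in> Z; y \<in> Z; z \<in> Z; w \<in> Z; x \<noteq> z; y \<noteq> w;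
           {x, y} \<in> edges G; {y, z} \<in> edges G; {z, w} \<in> edges G\<rbrakk> \<Longrightarrow> {w, x} \<notin> edges G"
  using assms unfolding hole_set_def by blast+

text \<open>Being a hole set depends only on adjacency among its own vertices, so it pulls back
  along any bijection that preserves and reflects adjacency. With vertex sets \<open>S\<close> and
  \<open>T\<close> chosen freely, one statement serves for isomorphisms, for changes of the graph
  outside \<open>Z\<close>, and for a copy sitting inside a larger graph.\<close>

lemma hole_set_bij:
  assumes f: "bij_betw f S T" and "S \<subseteq> verts G"
    and E: "\<And>x y. x \<in> S \<Longrightarrow> y \<in> S \<Longrightarrow> {x, y} \<in> edges G \<longleftrightarrow> {f x, f y} \<in> edges K"
    and "hole_set K Z" "Z \<subseteq> T"
  shows "hole_set G {x \<in> S. f x \<in> Z}"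
proof -
  let ?Y = "{x \<in> S. f x \<in> Z}"
  note Z = hole_setD[OF \<open>hole_set K Z\<close>]
  have surj: "\<exists>x\<in>?Y. f x = z" if "z \<in> Z" for z
    using f that \<open>Z \<subseteq> T\<close> by (auto simp: bij_betw_def)
  have inj: "f x = f y \<longleftrightarrow> x = y" if "x \<in> S" "y \<in> S" for x y
    using f that by (auto simp: bij_betw_def inj_on_def)
  have "\<exists>u v. u \<noteq> v \<and> nbrs G ?Y p = {u, v}" if p: "p \<in> ?Y" for p
  proof -
    obtain u v where uv: "u \<noteq> v" "nbrs K Z (f p) = {u, v}" using Z(3) p by blast
    then have "u \<in> Z" "v \<in> Z" by (auto simp: nbrs_def)
    then obtain u' v' where uv': "u' \<in> ?Y" "v' \<in> ?Y" "f u' = u" "f v' = v" using surj by meson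
    have "nbrs G ?Y p = {w \<in> ?Y. f w \<in> nbrs K Z (f p)}"
      using p E by (auto simp: nbrs_def)
    also have "\<dots> = {u', v'}" using uv(2) uv' inj by auto
    finally have "nbrs G ?Y p = {u', v'}" .
    moreover have "u' \<noteq> v'" using uv(1) uv' by blast
    ultimately show ?thesis by blast
  qed
  moreover have "?Y \<noteq> {}" using Z(1) surj by blast
  moreover have "{x, z} \<notin> edges G"
    if "x \<in> ?Y" "y \<in> ?Y" "z \<in> ?Y" "{x, y} \<in> edges G" "{y, z} \<in> edges G" for x y z
    using Z(4)[of "f x" "f y" "f z"] that E by auto
  moreover have "{w, x} \<notin> edges G"
    if "x \<in> ?Y" "y \<in> ?Y" "z \<in> ?Y" "w \<in> ?Y" "x \<noteq> z" "y \<noteq> w"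
      "{x, y} \<in> edges G" "{y, z} \<in> edges G" "{z, w} \<in> edges G" for x y z w
    using Z(5)[of "f x" "f y" "f z" "f w"] that E inj by auto
  ultimately show ?thesis
    using \<open>S \<subseteq> verts G\<close> by (intro hole_setI) blast+
qed

lemma hole_set_iso:
  assumes "graph_iso (induced_subgraph G S) K" "hole_set K Z" "S \<subseteq> verts G"
  shows "\<exists>Y\<subseteq>S. hole_set G Y"
proof -
  obtain f where f: "bij_betw f S (verts K)"
    and E: "\<And>x y. x \<in> S \<Longrightarrow> y \<in> S \<Longrightarrow> {x, y} \<in> edges G \<longleftrightarrow> {f x, f y} \<in> edges K"
    using assms(1) by (auto simp: graph_iso_def induced_subgraph_def verts_def edges_def)
  have "hole_set G {x \<in> S. f x \<in> Z}"
    using hole_set_bij[OF f assms(3) _ assms(2)] E hole_setD(2)[OF assms(2)] by blast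
  moreover have "{x \<in> S. f x \<in> Z} \<subseteq> S" by simp
  ultimately show ?thesis by metis
qed

text \<open>From five vertices on, the predecessor and the successor of a vertex differ, and going
  round takes more than four steps.\<close>

lemma hole_set_cycle_graph:
  assumes "n \<ge> 5"
  shows "hole_set (cycle_graph n) {..<n}"
proof -
  \<comment> \<open>A case distinction in place of \<open>mod\<close> leaves adjacency to linear
    arithmetic.\<close>
  define s where "s i = (if Suc i = n then 0 else Suc i)" for i
  have s: "Suc i mod n = s i" if "i < n" for i using that by (auto simp: s_def)
  have E: "{i, j} \<in> edges (cycle_graph n) \<longleftrightarrow> j = s i \<or> i = s j" if "i < n" "j < n" for i j
  proof -
    have "{i, j} \<in> edges (cycle_graph n) \<longleftrightarrow> (\<exists>k<n. {i, j} = {k, s k})"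
      using s unfolding cycle_graph_def edges_def snd_conv mem_Collect_eq by metis
    then show ?thesis using that by (auto simp: doubleton_eq_iff)
  qed
  have reg: "\<exists>u v. u \<noteq> v \<and> nbrs (cycle_graph n) {..<n} p = {u, v}" if "p \<in> {..<n}" for p
  proof -
    have p: "p < n" using that by simp
    have "nbrs (cycle_graph n) {..<n} p = {s p, if p = 0 then n - 1 else p - 1}"
      using p E assms by (auto simp: nbrs_def s_def split: if_splits)
    moreover have "s p \<noteq> (if p = 0 then n - 1 else p - 1)"
      using p assms by (auto simp: s_def)
    ultimately show ?thesis by blast
  qed
  have tri: "{x, z} \<notin> edges (cycle_graph n)"
    if "x \<in> {..<n}" "y \<in> {..<n}" "z \<in> {..<n}" "{x, y} \<in> edges (cycle_graph n)" "{y, z} \<in> edges (cycle_graph n)" for x y z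
    using that assms by (auto simp: E s_def split: if_splits)
  have quad: "{w, x} \<notin> edges (cycle_graph n)"
    if "x \<in> {..<n}" "y \<in> {..<n}" "z \<in> {..<n}" "w \<in> {..<n}" "x \<noteq> z" "y \<noteq> w"
      "{x, y} \<in> edges (cycle_graph n)" "{y, z} \<in> edges (cycle_graph n)"
      "{z, w} \<in> edges (cycle_graph n)" for x y z w
    using that assms by (auto simp: E s_def split: if_splits)
  have ne: "{..<n} \<noteq> {}" and sub: "{..<n} \<subseteq> verts (cycle_graph n)"
    using assms by (auto simp: cycle_graph_def verts_def lessThan_empty_iff)
  show ?thesis by (rule hole_setI) (fact ne sub reg tri quad)+
qed

section \<open>Persistence of holes under subdivision\<close>

text \<open>If \<open>Z\<close> misses an end of the subdivided edge, adjacency within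
  \<open>Z\<close> is unchanged. Otherwise \<open>z\<close> is inserted into the hole: degrees stay
  two, a triangle through \<open>z\<close> would need the deleted edge, and a 4-cycle through
  \<open>z\<close> would have been a triangle before.\<close>

lemma hole_set_subdivision_step:
  assumes wf: "wf_graph (V, E)" and xyE: "{x, y} \<in> E" and zV: "z \<notin> V" and "hole_set (V, E) Z"
  shows "\<exists>Z'. hole_set (insert z V, (E - {{x, y}}) \<union> {{x, z}, {z, y}}) Z'"
proof -
  define L where "L = (insert z V, (E - {{x, y}}) \<union> {{x, z}, {z, y}})"
  have xy: "x \<noteq> y" "x \<in> V" "y \<in> V"
    using wf_graph_edge[OF wf, of x y] xyE by (auto simp: verts_def edges_def)
  note Z = hole_setD[OF assms(4)]
  have ZV: "Z \<subseteq> V" using Z(2) by (simp add: verts_def)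
  have zE: "{u, z} \<notin> E" "{z, u} \<notin> E" for u
    using wf_graph_edge[OF wf, of u z] zV by (auto simp: verts_def edges_def insert_commute)
  have L1: "{u, v} \<in> edges L \<longleftrightarrow> {u, v} \<in> E \<and> {u, v} \<noteq> {x, y}" if "u \<in> V" "v \<in> V" for u v
    using that zV by (auto simp: L_def edges_def doubleton_eq_iff)
  have L2: "{u, z} \<in> edges L \<longleftrightarrow> u = x \<or> u = y" "{z, u} \<in> edges L \<longleftrightarrow> u = x \<or> u = y" for u
    using zE xy zV by (auto simp: L_def edges_def doubleton_eq_iff)
  show ?thesis
  proof (cases "x \<in> Z \<and> y \<in> Z")
    case False
    then have "{u, v} \<in> edges L \<longleftrightarrow> {u, v} \<in> edges (V, E)" if "u \<in> Z" "v \<in> Z" for u v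
      using that ZV by (subst L1) (auto simp: doubleton_eq_iff edges_def)
    then have "hole_set L {u \<in> Z. id u \<in> Z}"
      using assms(4) ZV by (intro hole_set_bij[where T = Z]) (auto simp: L_def verts_def bij_betw_def)
    then show ?thesis unfolding L_def by blast
  next
    case True
    let ?Z = "insert z Z"
    have zZ: "z \<notin> Z" using ZV zV by blast
    have reg: "\<exists>u v. u \<noteq> v \<and> nbrs L ?Z p = {u, v}" if "p \<in> ?Z" for p
    proof (cases "p = z")
      case True
      then have "nbrs L ?Z p = {x, y}"
        using \<open>x \<in> Z \<and> y \<in> Z\<close> xy zV by (auto simp: nbrs_def L2)
      then show ?thesis using xy by blast
    next
      case False
      then have p: "p \<in> Z" using that by blast
      obtain u v where uv: "u \<noteq> v" "nbrs (V, E) Z p = {u, v}" using Z(3) p by blast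
      have N: "w \<in> Z \<and> {p, w} \<in> E \<longleftrightarrow> w = u \<or> w = v" for w
        using uv(2) by (auto simp: nbrs_def edges_def set_eq_iff)
      have M: "nbrs L ?Z p = {w \<in> Z. {p, w} \<in> E \<and> {p, w} \<noteq> {x, y}} \<union> {w. w = z \<and> (p = x \<or> p = y)}"
      proof -
        have "{p, w} \<in> edges L \<longleftrightarrow> {p, w} \<in> E \<and> {p, w} \<noteq> {x, y}" if "w \<in> Z" for w
          using L1 p that ZV by blast
        then show ?thesis unfolding nbrs_def using L2(1)[of p] zZ by blast
      qed
      show ?thesis
      proof (cases "p = x \<or> p = y")
        case True
        \<comment> \<open>At an end \<open>p\<close> of the subdivided edge, the neighbour
          \<open>w\<close> across that edge is replaced by \<open>z\<close>; \<open>w'\<close> is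
          the other old neighbour.\<close>
        define w where "w = (if p = x then y else x)"
        have w: "w = u \<or> w = v"
          using True \<open>x \<in> Z \<and> y \<in> Z\<close> xyE N[of w] by (auto simp: w_def insert_commute)
        define w' where "w' = (if w = u then v else u)"
        have pw: "{p, c} = {x, y} \<longleftrightarrow> c = w" for c
          using True xy by (auto simp: w_def doubleton_eq_iff)
        have "nbrs L ?Z p = {w', z}"
          unfolding M pw using N w uv(1) True by (auto simp: w'_def)
        moreover have "w' \<noteq> z" using N[of w'] zZ by (auto simp: w'_def split: if_splits)
        ultimately show ?thesis by blast
      next
        case False
        then have "nbrs L ?Z p = {u, v}"
          unfolding M using N by (auto simp: doubleton_eq_iff)
        then show ?thesis using uv(1) by blast
      qed
    qed
    have ne: "?Z \<noteq> {}" by simp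
    have LE: "{u, v} \<in> edges L \<Longrightarrow> {u, v} \<in> edges (V, E)" if "u \<in> Z" "v \<in> Z" for u v
      using that ZV L1 by (auto simp: edges_def)
    have nxy: "{u, v} \<notin> edges L" if "u = x \<or> u = y" "v = x \<or> v = y" for u v
      using L1[of u v] that xy wf_graph_edge(1)[OF wf, of u v] by (auto simp: insert_commute edges_def)
    have tri: "{a, c} \<notin> edges L"
      if abc: "a \<in> ?Z" "b \<in> ?Z" "c \<in> ?Z" "{a, b} \<in> edges L" "{b, c} \<in> edges L" for a b c
    proof
      assume ac: "{a, c} \<in> edges L"
      have zz: "{z, z} \<notin> edges L" using L2(1)[of z] xy zV by blast
      consider "a = z" | "b = z" | "c = z" | "a \<in> Z" "b \<in> Z" "c \<in> Z" using abc by blast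
      then show False
      proof cases
        case 4 then show False using Z(4)[of a b c] LE abc ac by blast
      next
        case 1 then show False using nxy[of b c] abc ac L2 by blast
      next
        case 2 then show False using nxy[of a c] abc ac L2 by blast
      next
        case 3 then show False using nxy[of a b] abc ac L2 by blast
      qed
    qed
    have no_common: False
      if "w \<in> Z" "{x, w} \<in> edges L" "{w, y} \<in> edges L" for w
      using Z(4)[of x w y] LE that True xyE by (auto simp: edges_def)
    have quad: "{d, a} \<notin> edges L"
      if abcd: "a \<in> ?Z" "b \<in> ?Z" "c \<in> ?Z" "d \<in> ?Z" "a \<noteq> c" "b \<noteq> d"
        "{a, b} \<in> edges L" "{b, c} \<in> edges L" "{c, d} \<in> edges L" for a b c d
    proof
      assume da: "{d, a} \<in> edges L"
      have zz: "{z, z} \<notin> edges L" using L2(1)[of z] xy zV by blast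
      \<comment> \<open>In a 4-cycle through \<open>z\<close> the neighbours of \<open>z\<close> are
        \<open>x\<close> and \<open>y\<close>, so the opposite vertex \<open>f\<close> formed a
        triangle with the old edge \<open>{x, y}\<close>. The first four cases below rotate
        \<open>z\<close> into this position.\<close>
      have key: False if "e \<in> ?Z" "g \<in> ?Z" "f \<in> ?Z" "e \<noteq> g" "f \<noteq> z"
        "{z, e} \<in> edges L" "{z, g} \<in> edges L" "{e, f} \<in> edges L" "{f, g} \<in> edges L" for e f g
      proof -
        have "e = x \<and> g = y \<or> e = y \<and> g = x" using that L2(2) by metis
        then show False using no_common[of f] that by (auto simp: insert_commute)
      qed
      consider "a = z" | "b = z" | "c = z" | "d = z" | "a \<in> Z" "b \<in> Z" "c \<in> Z" "d \<in> Z"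
        using abcd by blast
      then show False
      proof cases
        case 1 then show False using key[of b d c] abcd da by (auto simp: insert_commute)
      next
        case 2 then show False using key[of c a d] abcd da by (auto simp: insert_commute)
      next
        case 3 then show False using key[of d b a] abcd da by (auto simp: insert_commute)
      next
        case 4 then show False using key[of a c b] abcd da by (auto simp: insert_commute)
      next
        case 5 then show False using Z(5)[of a b c d] LE abcd da by blast
      qed
    qed
    have sub: "?Z \<subseteq> verts L" using ZV by (auto simp: L_def verts_def)
    have "hole_set L ?Z"
      by (rule hole_setI) (fact ne sub reg tri quad)+
    then show ?thesis unfolding L_def by blast
  qed
qed

text \<open>Applied to the subdivision that an induced subgraph is isomorphic to, this puts a hole
  into every induced subdivision of \<open>H\<close>.\<close>

lemma hole_set_subdivision:
  assumes "subdivision_of H K" "wf_graph H" "hole_set H Z"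
  shows "\<exists>Z'. hole_set K Z'"
  using assms(1)
proof induction
  case base
  have E: "{Inl x, Inl y :: 'a + nat} \<in> (`) Inl ` edges H \<longleftrightarrow> {x, y} \<in> edges H" for x y
  proof
    assume "{Inl x, Inl y :: 'a + nat} \<in> (`) Inl ` edges H"
    then obtain e where e: "e \<in> edges H" "{Inl x, Inl y :: 'a + nat} = Inl ` e" by blast
    then have "(Inl ` {x, y} :: ('a + nat) set) = Inl ` e" by simp
    then have "{x, y} = e" by (simp only: inj_image_eq_iff[OF inj_Inl])
    then show "{x, y} \<in> edges H" using e by simp
  next
    assume "{x, y} \<in> edges H"
    then have "(Inl ` {x, y} :: ('a + nat) set) \<in> (`) Inl ` edges H" by (rule imageI)
    then show "{Inl x, Inl y :: 'a + nat} \<in> (`) Inl ` edges H" by simp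
  qed
  have "hole_set (Inl ` verts H :: ('a + nat) set, (`) Inl ` edges H) {x \<in> Inl ` Z. projl x \<in> Z}"
  proof (rule hole_set_bij[where T = Z and K = H])
    show "bij_betw projl (Inl ` Z :: ('a + nat) set) Z" by (auto simp: bij_betw_def inj_on_def image_image)
    show "(Inl ` Z :: ('a + nat) set) \<subseteq> verts (Inl ` verts H, (`) Inl ` edges H)"
      using hole_setD(2)[OF assms(3)] by (auto simp: verts_def)
    show "{x, y} \<in> edges (Inl ` verts H, (`) Inl ` edges H) \<longleftrightarrow> {projl x, projl y} \<in> edges H"
      if "x \<in> Inl ` Z" "y \<in> Inl ` Z" for x y :: "'a + nat"
      using that E by (force simp: edges_def)
  qed (use assms(3) in auto)
  then show ?case by blast
next
  case (step V E x y z)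
  have "wf_graph (V, E)" using step.hyps(1) assms(2) by (rule wf_graph_subdivision)
  with step show ?case by (meson hole_set_subdivision_step)
qed

section \<open>Transport along bijections and the choice of vertex type\<close>

lemma graph_iso_induced_bij:
  assumes h: "bij_betw h T S"
    and E: "\<And>x y. x \<in> T \<Longrightarrow> y \<in> T \<Longrightarrow> {x, y} \<in> edges G' \<longleftrightarrow> {h x, h y} \<in> edges G"
    and "graph_iso (induced_subgraph G S) K"
  shows "graph_iso (induced_subgraph G' T) K"
proof -
  obtain f where f: "bij_betw f S (verts K)"
    and F: "\<And>x y. x \<in> S \<Longrightarrow> y \<in> S \<Longrightarrow> {x, y} \<in> edges G \<longleftrightarrow> {f x, f y} \<in> edges K"
    using assms(3) by (auto simp: graph_iso_def induced_subgraph_def verts_def edges_def)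
  have "bij_betw (f \<circ> h) T (verts K)" using h f by (rule bij_betw_trans)
  moreover have "{x, y} \<in> edges G' \<longleftrightarrow> {(f \<circ> h) x, (f \<circ> h) y} \<in> edges K" if "x \<in> T" "y \<in> T" for x y
    using that E F[of "h x" "h y"] h by (auto simp: bij_betw_def)
  ultimately show ?thesis
    unfolding graph_iso_def induced_subgraph_def verts_def edges_def by auto
qed

definition map_graph :: "('a \<Rightarrow> 'b) \<Rightarrow> 'a graph \<Rightarrow> 'b graph" where
  "map_graph g G = (g ` verts G, (`) g ` edges G)"

lemma wf_map_graph:
  assumes "wf_graph G" "inj_on g (verts G)"
  shows "wf_graph (map_graph g G)"
proof -
  have "card (g ` e) = 2" if "e \<in> edges G" for e
    using that assms card_image[of g e] inj_on_subset[of g "verts G" e]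
    by (simp add: wf_graph_def)
  then show ?thesis using assms by (auto simp: wf_graph_def map_graph_def verts_def edges_def)
qed

lemma map_graph_edge_iff:
  assumes "wf_graph G" "inj_on g (verts G)" "x \<in> verts G" "y \<in> verts G"
  shows "{g x, g y} \<in> edges (map_graph g G) \<longleftrightarrow> {x, y} \<in> edges G"
proof
  assume "{g x, g y} \<in> edges (map_graph g G)"
  then obtain e where e: "e \<in> edges G" "g ` {x, y} = g ` e" by (auto simp: map_graph_def edges_def)
  then have "{x, y} = e"
    using assms inj_on_image_eq_iff[of g "verts G" "{x, y}" e] by (auto simp: wf_graph_def)
  then show "{x, y} \<in> edges G" using e by simp
next
  assume "{x, y} \<in> edges G"
  then have "g ` {x, y} \<in> (`) g ` edges G" by (rule imageI)
  then show "{g x, g y} \<in> edges (map_graph g G)" by (simp add: map_graph_def edges_def)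
qed

lemma induced_subdivision_map_graph:
  fixes H :: "'h graph"
  assumes "wf_graph G" "inj_on g (verts G)" "S \<subseteq> verts G"
  shows "induced_subdivision H (map_graph g G) (g ` S) \<longleftrightarrow> induced_subdivision H G S"
proof -
  have g: "bij_betw g S (g ` S)" using assms(2,3) by (meson inj_on_imp_bij_betw inj_on_subset)
  have E: "{x, y} \<in> edges G \<longleftrightarrow> {g x, g y} \<in> edges (map_graph g G)" if "x \<in> S" "y \<in> S" for x y
    using map_graph_edge_iff[OF assms(1,2)] that assms(3) by blast
  have E': "{x, y} \<in> edges (map_graph g G) \<longleftrightarrow> {inv_into S g x, inv_into S g y} \<in> edges G"
    if "x \<in> g ` S" "y \<in> g ` S" for x y
    using that E g by (auto simp: bij_betw_def)
  have "graph_iso (induced_subgraph (map_graph g G) (g ` S)) K \<longleftrightarrow> graph_iso (induced_subgraph G S) K"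
    for K :: "('h + nat) graph"
  proof
    assume "graph_iso (induced_subgraph (map_graph g G) (g ` S)) K"
    then show "graph_iso (induced_subgraph G S) K" by (rule graph_iso_induced_bij[OF g E, rotated 2])
  next
    assume "graph_iso (induced_subgraph G S) K"
    then show "graph_iso (induced_subgraph (map_graph g G) (g ` S)) K"
      by (rule graph_iso_induced_bij[OF bij_betw_inv_into[OF g] E', rotated 2])
  qed
  moreover have "g ` S \<subseteq> verts (map_graph g G)" using assms(3) by (auto simp: map_graph_def verts_def)
  ultimately show ?thesis using assms(3) unfolding induced_subdivision_def by metis
qed

text \<open>A finite vertex set injects into the naturals, so counterexamples may live over any
  vertex type \<open>'b\<close>. One fixed \<open>k\<close> is enough, because a candidate bound
  gives it a single value \<open>f k\<close>, while \<open>N\<close> is arbitrary.\<close>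

lemma not_induced_EP_propertyI:
  fixes H :: "'a graph" and k :: nat
  assumes "k > 0"
    and "\<And>N :: nat. \<exists>G :: 'b graph. wf_graph G
      \<and> \<not> (\<exists>S :: nat \<Rightarrow> 'b set. (\<forall>i<k. induced_subdivision H G (S i))
             \<and> (\<forall>i<k. \<forall>j<k. i \<noteq> j \<longrightarrow> S i \<inter> S j = {}))
      \<and> (\<forall>X\<subseteq>verts G. card X \<le> N \<longrightarrow> (\<exists>S. induced_subdivision H G S \<and> S \<inter> X = {}))"
  shows "\<not> induced_EP_property H"
proof
  assume "induced_EP_property H"
  then obtain f :: "nat \<Rightarrow> real" where f: "\<And>(G :: nat graph) k. wf_graph G \<Longrightarrow> k > 0 \<Longrightarrow>
      (\<exists>S :: nat \<Rightarrow> nat set. (\<forall>i<k. induced_subdivision H G (S i)) \<and>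
          (\<forall>i<k. \<forall>j<k. i \<noteq> j \<longrightarrow> S i \<inter> S j = {}))
    \<or> (\<exists>X. X \<subseteq> verts G \<and> real (card X) \<le> f k \<and>
          (\<forall>S. induced_subdivision H G S \<longrightarrow> S \<inter> X \<noteq> {}))"
    unfolding induced_EP_property_def by blast
  obtain G :: "'b graph" where wf: "wf_graph G"
    and pack: "\<not> (\<exists>S :: nat \<Rightarrow> 'b set. (\<forall>i<k. induced_subdivision H G (S i))
             \<and> (\<forall>i<k. \<forall>j<k. i \<noteq> j \<longrightarrow> S i \<inter> S j = {}))"
    and cover: "\<And>X. X \<subseteq> verts G \<Longrightarrow> card X \<le> nat \<lfloor>f k\<rfloor> \<Longrightarrow>
             \<exists>S. induced_subdivision H G S \<and> S \<inter> X = {}"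
    \<comment> \<open>Cardinalities are integers, so a cardinality of at most \<open>f k\<close> is
      at most its floor.\<close>
    using assms(2)[of "nat \<lfloor>f k\<rfloor>"] by blast
  obtain g :: "'b \<Rightarrow> nat" where g: "inj_on g (verts G)"
    using wf finite_imp_inj_to_nat_seg[of "verts G"] by (auto simp: wf_graph_def)
  let ?M = "map_graph g G"
  have VM: "verts ?M = g ` verts G" by (simp add: map_graph_def verts_def)
  have pull: "\<exists>S'\<subseteq>verts G. S = g ` S'" if "S \<subseteq> verts ?M" for S
    using that unfolding VM by (simp add: subset_image_iff)
  from f[OF wf_map_graph[OF wf g] assms(1)] show False
  proof
    assume "\<exists>S. (\<forall>i<k. induced_subdivision H ?M (S i)) \<and> (\<forall>i<k. \<forall>j<k. i \<noteq> j \<longrightarrow> S i \<inter> S j = {})"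
    then obtain S where S: "\<And>i. i < k \<Longrightarrow> induced_subdivision H ?M (S i)"
      and disj: "\<And>i j. i < k \<Longrightarrow> j < k \<Longrightarrow> i \<noteq> j \<Longrightarrow> S i \<inter> S j = {}" by blast
    have "\<exists>S'. i < k \<longrightarrow> S' \<subseteq> verts G \<and> S i = g ` S'" for i
      using pull[of "S i"] S[of i] unfolding induced_subdivision_def by blast
    then obtain S' where S': "\<And>i. i < k \<Longrightarrow> S' i \<subseteq> verts G \<and> S i = g ` S' i" by metis
    have "induced_subdivision H G (S' i)" if "i < k" for i
      using S'[OF that] S[OF that] induced_subdivision_map_graph[OF wf g] by metis
    moreover have "S' i \<inter> S' j = {}" if "i < k" "j < k" "i \<noteq> j" for i j
      using disj[OF that] S'[OF that(1)] S'[OF that(2)] by auto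
    ultimately show False using pack by blast
  next
    assume "\<exists>X\<subseteq>verts ?M. real (card X) \<le> f k \<and> (\<forall>S. induced_subdivision H ?M S \<longrightarrow> S \<inter> X \<noteq> {})"
    then obtain X where X: "X \<subseteq> verts ?M" "real (card X) \<le> f k"
      and hit: "\<And>S. induced_subdivision H ?M S \<Longrightarrow> S \<inter> X \<noteq> {}" by blast
    obtain X' where X': "X' \<subseteq> verts G" "X = g ` X'" using pull[OF X(1)] by metis
    have "card X' = card X" using X' g by (metis card_image inj_on_subset)
    then have "card X' \<le> nat \<lfloor>f k\<rfloor>" using X(2) by linarith
    then obtain S where S: "induced_subdivision H G S" "S \<inter> X' = {}" using cover X'(1) by blast
    have SG: "S \<subseteq> verts G" using S(1) by (simp add: induced_subdivision_def)
    then have "g ` S \<inter> X = {}" using S(2) X' g inj_on_image_Int[of g "verts G" S X'] by simp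
    moreover have "induced_subdivision H ?M (g ` S)"
      using S(1) SG induced_subdivision_map_graph[OF wf g] by blast
    ultimately show False using hit by blast
  qed
qed

section \<open>Holes in graphs with indexed vertices\<close>

text \<open>Take a vertex \<open>y\<close> of the hole outside \<open>X\<close>, with index \<open>i\<close>. Its non-neighbours in the hole all
  have index \<open>i\<close>; a neighbour without index \<open>i\<close> would see every vertex of the hole outside \<open>X\<close>
  with index \<open>i\<close>, which is too many because \<open>X\<close> is independent.\<close>

lemma hole_set_common_index:
  fixes I :: "'b \<Rightarrow> 'c set"
  assumes Z: "hole_set G Z"
    and disj: "\<And>p q. \<lbrakk>p \<in> verts G; q \<in> verts G; I p \<inter> I q = {}; p \<notin> X\<rbrakk> \<Longrightarrow> {p, q} \<in> edges G"
    and indep: "\<And>p q. \<lbrakk>p \<in> X; q \<in> X\<rbrakk> \<Longrightarrow> {p, q} \<notin> edges G"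
    and single: "\<And>p. \<lbrakk>p \<in> verts G; p \<notin> X\<rbrakk> \<Longrightarrow> \<exists>i. I p = {i}"
  obtains i where "\<And>p. p \<in> Z \<Longrightarrow> i \<in> I p"
proof -
  note H = hole_setD[OF Z]
  have com: "{p, q} \<in> edges G \<longleftrightarrow> {q, p} \<in> edges G" for p q by (simp add: insert_commute)
  have N: "\<exists>u v. u \<noteq> v \<and> u \<in> Z \<and> v \<in> Z \<and> (\<forall>w\<in>Z. {p, w} \<in> edges G \<longleftrightarrow> w = u \<or> w = v)"
    if "p \<in> Z" for p
    using H(3)[OF that] unfolding nbrs_def by blast
  have N': "\<exists>v\<in>Z. v \<noteq> u \<and> {p, v} \<in> edges G \<and> (\<forall>w\<in>Z. {p, w} \<in> edges G \<longleftrightarrow> w = u \<or> w = v)"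
    if "p \<in> Z" "u \<in> Z" "{p, u} \<in> edges G" for p u
    using N[OF that(1)] that by metis
  \<comment> \<open>Two adjacent vertices of the hole cannot both lie in the independent set
    \<open>X\<close>.\<close>
  obtain y where y: "y \<in> Z" "y \<notin> X"
  proof -
    obtain p where p: "p \<in> Z" using H(1) by blast
    obtain u where "u \<in> Z" "{p, u} \<in> edges G" using N[OF p] by blast
    then show ?thesis using indep[of p u] p that by blast
  qed
  obtain i where i: "I y = {i}" using single y H(2) by blast
  \<comment> \<open>Outside \<open>X\<close> index sets are singletons, so a vertex with index
    \<open>i\<close> there is joined to every vertex lacking \<open>i\<close>.\<close>
  have priv: "{u, p} \<in> edges G" if "u \<in> Z" "i \<notin> I u" "p \<in> Z" "p \<notin> X" "i \<in> I p" for u p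
  proof -
    have "I p = {i}" using single[of p] that H(2) by (metis singletonD subsetD)
    then have "{p, u} \<in> edges G" using disj[of p u] that H(2) by auto
    then show ?thesis using com by blast
  qed
  have "i \<in> I u" if u: "u \<in> Z" for u
  proof (rule ccontr)
    assume iu: "i \<notin> I u"
    have yu: "{y, u} \<in> edges G" using priv[OF u iu y(1,2)] i com by auto
    obtain v where v: "v \<in> Z" "v \<noteq> u" "{y, v} \<in> edges G"
      and Ny: "\<And>w. w \<in> Z \<Longrightarrow> {y, w} \<in> edges G \<longleftrightarrow> w = u \<or> w = v"
      using N'[OF y(1) u yu] by blast
    have uv: "{u, v} \<notin> edges G" using H(4)[of u y v] u v y yu com by blast
    have far: "i \<in> I w" if "w \<in> Z" "w \<noteq> u" "w \<noteq> v" for w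
      using Ny[OF that(1)] that disj[of y w] y H(2) i by auto
    \<comment> \<open>\<open>q\<close> and \<open>s\<close> continue the hole beyond
      \<open>u\<close>; the plan is to close it up as the pentagon \<open>y\<close>,
      \<open>u\<close>, \<open>q\<close>, \<open>s\<close>, \<open>v\<close>.\<close>
    obtain q where q: "q \<in> Z" "q \<noteq> y" "{u, q} \<in> edges G"
      and Nu: "\<And>w. w \<in> Z \<Longrightarrow> {u, w} \<in> edges G \<longleftrightarrow> w = y \<or> w = q"
      using N'[OF u y(1)] yu com by blast
    have qv: "q \<noteq> v" using q uv by blast
    have qu: "q \<noteq> u" using Ny[of u] H(4)[of u u u] u q yu by blast
    have iq: "i \<in> I q" using far q(1) qv qu by blast
    obtain s where s: "s \<in> Z" "s \<noteq> u" "{q, s} \<in> edges G"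
      using N'[OF q(1) u] q(3) com by blast
    have sq: "s \<noteq> q" using H(4)[of s s s] s by blast
    have sy: "s \<noteq> y" using H(4)[of y u q] s q u y yu com by blast
    have sv: "s \<noteq> v" using H(5)[of y u q v] s q u v y yu com by blast
    \<comment> \<open>\<open>s\<close> carries \<open>i\<close> but is no neighbour of
      \<open>u\<close>, which by \<open>priv\<close> is possible only inside
      \<open>X\<close>.\<close>
    have sX: "s \<in> X"
      using priv[OF u iu s(1)] far[OF s(1,2) sv] Nu[OF s(1)] sy sq by blast
    have qX: "q \<notin> X" using indep[OF _ sX, of q] s(3) by blast
    \<comment> \<open>The second neighbour \<open>c\<close> of \<open>s\<close> lies outside
      \<open>X\<close>. If it carried \<open>i\<close> it would be adjacent to \<open>u\<close>,
      hence equal to \<open>y\<close> or \<open>q\<close>; so it lacks \<open>i\<close>, and only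
      \<open>v\<close> remains.\<close>
    have sv_edge: "{s, v} \<in> edges G"
    proof -
      obtain c where c: "c \<in> Z" "c \<noteq> q" "{s, c} \<in> edges G"
        using N'[OF s(1) q(1)] s(3) com by blast
      have "c \<notin> X" using indep[OF sX, of c] c(3) by blast
      moreover have "c \<noteq> u" using Nu[OF s(1)] c(3) com sy sq by blast
      moreover have "c \<noteq> y" using Ny[OF s(1)] c(3) com s(2) sv by blast
      ultimately have "c = v"
        using priv[OF u iu c(1)] far[OF c(1)] Nu[OF c(1)] c(2) by blast
      then show ?thesis using c(3) by simp
    qed
    have vX: "v \<notin> X" using indep[OF sX, of v] sv_edge by blast
    have vq: "{v, q} \<notin> edges G" using H(4)[of v s q] v s q sv_edge com by blast
    \<comment> \<open>Without index \<open>i\<close>, \<open>v\<close> would be adjacent to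
      \<open>q\<close>. With it, \<open>v\<close> is adjacent to \<open>u\<close>, which is also
      excluded.\<close>
    have "i \<in> I v" using priv[OF v(1) _ q(1) qX iq] vq by blast
    then show False using priv[OF u iu v(1) vX] uv by blast
  qed
  then show ?thesis using that by blast
qed

section \<open>Subdivisions with prescribed edge lengths\<close>

locale edge_enumeration =
  fixes H :: "'a graph" and a b :: "nat \<Rightarrow> 'a" and q :: nat
  assumes wfH: "wf_graph H"
    and inj: "inj_on (\<lambda>t. {a t, b t}) {..<q}"
    and edges_eq: "edges H = (\<lambda>t. {a t, b t}) ` {..<q}"
begin

text \<open>Subdivisions have vertices in \<open>'a + nat\<close>, so edge number and position are
  packed into one natural number; the vertices of \<open>H\<close> occupy the \<open>Inl\<close>
  side.\<close>

definition mid :: "nat \<Rightarrow> nat \<Rightarrow> 'a + nat" where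
  "mid t j = Inr (prod_encode (t, j))"

text \<open>Every position beyond \<open>s\<close> stands for the end \<open>b t\<close>; thus
  position \<open>Suc s\<close> closes the path, and \<open>s = 0\<close> gives back the original
  edge.\<close>

definition pt :: "nat \<Rightarrow> nat \<Rightarrow> nat \<Rightarrow> 'a + nat" where
  "pt s t j = (if j = 0 then Inl (a t) else if j \<le> s then mid t j else Inl (b t))"

definition sub_edges :: "nat \<Rightarrow> nat \<Rightarrow> ('a + nat) set set" where
  "sub_edges s t = (\<lambda>j. {pt s t j, pt s t (Suc j)}) ` {..s}"

text \<open>Lengths may differ from edge to edge, so that adding one vertex at a time stays within
  this family.\<close>

definition subdiv :: "(nat \<Rightarrow> nat) \<Rightarrow> ('a + nat) graph" where
  "subdiv \<sigma> = (Inl ` verts H \<union> (\<Union>t<q. mid t ` {1..\<sigma> t}), \<Union>t<q. sub_edges (\<sigma> t) t)"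

lemma mid_eq_iff [simp]: "mid t j = mid t' j' \<longleftrightarrow> t = t' \<and> j = j'"
  by (simp add: mid_def)

lemma mid_neq_Inl [simp]: "mid t j \<noteq> Inl x" "Inl x \<noteq> mid t j"
  by (simp_all add: mid_def)

lemma ends_distinct:
  assumes "t < q"
  shows "a t \<noteq> b t"
proof -
  have "{a t, b t} \<in> edges H" using assms edges_eq by blast
  then show ?thesis by (rule wf_graph_edge(1)[OF wfH])
qed

lemma pt_eq_midD: "pt s t j = mid t' j' \<Longrightarrow> t' = t \<and> j' = j \<and> 1 \<le> j \<and> j \<le> s"
  by (auto simp: pt_def split: if_splits)

text \<open>Subdividing the last edge of path \<open>t\<close>, the one ending in
  \<open>b t\<close>, puts the new vertex at the next position and keeps all earlier names.\<close>

lemma subdivision_of_subdiv_step: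
  assumes "subdivision_of H (subdiv \<sigma>)" "t < q"
  shows "subdivision_of H (subdiv (\<sigma>(t := Suc (\<sigma> t))))"
proof -
  define s x y z where "s = \<sigma> t" and "x = pt s t s" and "y = (Inl (b t) :: 'a + nat)" and "z = mid t (Suc s)"
  \<comment> \<open>\<open>C\<close> collects the edges of path \<open>t\<close> before its last
    one, \<open>D\<close> the edges of all other paths.\<close>
  define C where "C = (\<lambda>j. {pt s t j, pt s t (Suc j)}) ` {..<s}"
  define D where "D = (\<Union>t'\<in>{..<q} - {t}. sub_edges (\<sigma> t') t')"
  have ab: "a t \<noteq> b t" using ends_distinct assms(2) .
  have s1: "sub_edges s t = insert {x, y} C"
    by (simp add: sub_edges_def C_def x_def y_def atMost_Suc lessThan_Suc_atMost[symmetric] lessThan_Suc pt_def)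
  have C': "C = (\<lambda>j. {pt (Suc s) t j, pt (Suc s) t (Suc j)}) ` {..<s}"
    unfolding C_def by (rule image_cong) (auto simp: pt_def)
  have s2: "sub_edges (Suc s) t = C \<union> {{x, z}, {z, y}}"
    unfolding C'
    by (auto simp: sub_edges_def x_def y_def z_def lessThan_Suc_atMost[symmetric] lessThan_Suc pt_def)
  have xyC: "{x, y} \<notin> C"
  proof
    assume "{x, y} \<in> C"
    then obtain j where j: "j < s" "y = pt s t j \<or> y = pt s t (Suc j)"
      unfolding C_def by blast
    then show False using ab by (auto simp: y_def pt_def split: if_splits)
  qed
  \<comment> \<open>Another path \<open>t'\<close> could contain this pair only if both paths are
    still single edges; then \<open>t\<close> and \<open>t'\<close> would enumerate the same edge of
    \<open>H\<close>.\<close>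
  have xyD: "{x, y} \<notin> D"
  proof
    assume "{x, y} \<in> D"
    then obtain t' j where t': "t' < q" "t' \<noteq> t" and j: "j \<le> \<sigma> t'"
      and e: "{x, y} = {pt (\<sigma> t') t' j, pt (\<sigma> t') t' (Suc j)}"
      by (auto simp: D_def sub_edges_def)
    have "x \<noteq> mid t s" using e t' pt_eq_midD by (metis doubleton_eq_iff)
    then have x: "x = Inl (a t)" by (auto simp: x_def pt_def split: if_splits)
    have "j = 0" "\<sigma> t' = 0"
      using e x j by (auto simp: y_def pt_def doubleton_eq_iff split: if_splits)
    then have "{a t, b t} = {a t', b t'}"
      using e x by (auto simp: y_def pt_def doubleton_eq_iff)
    then show False using inj t' assms(2) by (auto simp: inj_on_def)
  qed
  have V: "fst (subdiv (\<sigma>(t := Suc s))) = insert z (fst (subdiv \<sigma>))"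
  proof -
    have "(\<Union>t'<q. mid t' ` {1..(\<sigma>(t := Suc s)) t'}) = insert z (\<Union>t'<q. mid t' ` {1..\<sigma> t'})"
      using assms(2) by (force simp: z_def s_def le_Suc_eq split: if_splits)
    then show ?thesis by (simp add: subdiv_def)
  qed
  have split: "(\<Union>t'<q. F t') = (\<Union>t'\<in>{..<q} - {t}. F t') \<union> F t" for F :: "nat \<Rightarrow> ('a + nat) set set"
    using assms(2) by blast
  have E: "snd (subdiv \<sigma>) = D \<union> insert {x, y} C"
    unfolding subdiv_def snd_conv split D_def using s1 by (simp add: s_def)
  have E': "snd (subdiv (\<sigma>(t := Suc s))) = D \<union> (C \<union> {{x, z}, {z, y}})"
    unfolding subdiv_def snd_conv split D_def using s2 by simp
  have zV: "z \<notin> fst (subdiv \<sigma>)" by (auto simp: subdiv_def z_def s_def)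
  have "subdivision_of H (insert z (fst (subdiv \<sigma>)), (snd (subdiv \<sigma>) - {{x, y}}) \<union> {{x, z}, {z, y}})"
  proof (rule subdivision_of.step)
    show "subdivision_of H (fst (subdiv \<sigma>), snd (subdiv \<sigma>))" using assms(1) by simp
    show "{x, y} \<in> snd (subdiv \<sigma>)" using E by simp
  qed (fact zV)
  also have "(snd (subdiv \<sigma>) - {{x, y}}) \<union> {{x, z}, {z, y}} = snd (subdiv (\<sigma>(t := Suc s)))"
    unfolding E E' using xyC xyD by blast
  finally show ?thesis unfolding V[symmetric] s_def by simp
qed

text \<open>Induction on the total number of inner vertices, undoing one subdivision on some edge
  with \<open>\<sigma> t \<noteq> 0\<close>.\<close>

lemma subdivision_of_subdiv: "subdivision_of H (subdiv \<sigma>)"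
proof (induction "sum \<sigma> {..<q}" arbitrary: \<sigma>)
  case 0
  then have "\<sigma> t = 0" if "t < q" for t using that by simp
  then have "subdiv \<sigma> = (Inl ` verts H, (\<lambda>e. Inl ` e) ` edges H)"
    by (auto simp: subdiv_def sub_edges_def pt_def edges_eq image_iff)
  then show ?case by (simp add: subdivision_of.base)
next
  case (Suc N)
  then obtain t where t: "t < q" "\<sigma> t \<noteq> 0"
    by (metis lessThan_iff nat.distinct(1) sum.neutral)
  define \<tau> where "\<tau> = \<sigma>(t := \<sigma> t - 1)"
  have \<sigma>: "\<sigma> = \<tau>(t := Suc (\<tau> t))" using t by (auto simp: \<tau>_def)
  have "sum \<sigma> {..<q} = Suc (sum \<tau> {..<q})"
    using t by (simp add: \<tau>_def sum.remove[of _ t])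
  then have "subdivision_of H (subdiv \<tau>)" using Suc by simp
  then show ?case using subdivision_of_subdiv_step t(1) \<sigma> by metis
qed

end

section \<open>Copies glued at crossing vertices\<close>

locale crossing_copies = edge_enumeration H a b q
  for H :: "'a graph" and a b :: "nat \<Rightarrow> 'a" and q :: nat +
  fixes n :: nat
begin

text \<open>The even positions \<open>2 * l\<close> with \<open>1 \<le> l \<le> n\<close> are the
  meeting points with copy \<open>l\<close>; the odd positions up to \<open>2 * n + 1\<close>
  separate them from each other and from the ends.\<close>

definition r :: nat where
  "r = 2 * n + 1"

abbreviation K :: "('a + nat) graph" where
  "K \<equiv> subdiv (\<lambda>_. r)"

lemma wf_K: "wf_graph K"
  using wf_graph_subdivision subdivision_of_subdiv wfH .

lemma K_edge_iff:
  "{u, v} \<in> edges K \<longleftrightarrow>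
     (\<exists>t<q. \<exists>j\<le>r. {u, v} = {pt (r) t j, pt (r) t (Suc j)})"
  by (auto simp: subdiv_def edges_def sub_edges_def)

lemma mid_in_K_iff: "mid t j \<in> verts K \<longleftrightarrow> t < q \<and> 1 \<le> j \<and> j \<le> r"
proof -
  have "mid t j \<in> (\<Union>t<q. mid t ` {1..r}) \<longleftrightarrow> t < q \<and> 1 \<le> j \<and> j \<le> r" by (force simp del: UN_simps)
  then show ?thesis by (auto simp: subdiv_def verts_def)
qed

lemma mid_nbrD:
  assumes "{mid t j, w} \<in> edges K"
  shows "w = pt (r) t (j - 1) \<or> w = pt (r) t (Suc j)"
proof -
  obtain t' j' where e: "{mid t j, w} = {pt (r) t' j', pt (r) t' (Suc j')}"
    using assms K_edge_iff by blast
  then consider "pt (r) t' j' = mid t j" "w = pt (r) t' (Suc j')"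
    | "pt (r) t' (Suc j') = mid t j" "w = pt (r) t' j'"
    by (metis doubleton_eq_iff)
  then show ?thesis by cases (auto dest: pt_eq_midD)
qed

text \<open>An inner vertex has only two possible neighbours, and a hole through it must use both.
  So the hole spreads in both directions until it fills the path.\<close>

lemma hole_set_contains_run:
  assumes "hole_set K Z"
  obtains t where "t < q" "\<And>j. 1 \<le> j \<Longrightarrow> j \<le> r \<Longrightarrow> mid t j \<in> Z"
proof -
  note Z = hole_setD[OF assms]
  obtain p where p: "p \<in> Z" using Z(1) by blast
  obtain w where w: "w \<in> Z" "{p, w} \<in> edges K" using Z(3)[OF p] by (auto simp: nbrs_def)
  obtain t j where t: "t < q" "j \<le> r" "{p, w} = {pt r t j, pt r t (Suc j)}"
    using w(2) K_edge_iff by blast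
  then have "pt r t j \<in> Z" "pt r t (Suc j) \<in> Z" using p w(1) by (metis insertCI insertE singletonD)+
  \<comment> \<open>Every edge of \<open>K\<close> has an inner end: position \<open>j\<close> if
    \<open>j > 0\<close>, and otherwise position \<open>1\<close>, as
    \<open>r \<ge> 1\<close>.\<close>
  then obtain j0 where j0: "1 \<le> j0" "j0 \<le> r" "mid t j0 \<in> Z"
    using t(2) that[of j] that[of "Suc j"] by (cases "j = 0") (auto simp: pt_def r_def split: if_splits)
  have both: "pt r t (j - 1) \<in> Z \<and> pt r t (Suc j) \<in> Z" if mj: "mid t j \<in> Z" for j
  proof -
    obtain u v where uv: "u \<noteq> v" "nbrs K Z (mid t j) = {u, v}" using Z(3)[OF mj] by blast
    then have "u \<in> Z" "v \<in> Z" "{mid t j, u} \<in> edges K" "{mid t j, v} \<in> edges K"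
      by (auto simp: nbrs_def)
    then show ?thesis using uv(1) mid_nbrD[of t j u] mid_nbrD[of t j v] by metis
  qed
  have up: "j \<le> r \<longrightarrow> mid t j \<in> Z" if "j0 \<le> j" for j
    using that
  proof (induction rule: dec_induct)
    case base
    then show ?case using j0 by blast
  next
    case (step j)
    then show ?case using both[of j] j0(1) by (auto simp: pt_def split: if_splits)
  qed
  have down: "1 \<le> j \<longrightarrow> mid t j \<in> Z" if "j \<le> j0" for j
    using that
  proof (induction rule: inc_induct)
    case base
    then show ?case using j0 by blast
  next
    case (step j)
    then show ?case using both[of "Suc j"] j0(2) by (auto simp: pt_def split: if_splits)
  qed
  have "mid t j \<in> Z" if "1 \<le> j" "j \<le> r" for j
    using up[of j] down[of j] that by (meson nle_le)
  then show ?thesis using that t(1) by blast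
qed

text \<open>The first component of a vertex is the set of copies containing it: the point at position
  \<open>2 * l\<close> of a subdivided edge in copy \<open>i\<close> is identified with the point at position \<open>2 * i\<close>
  of the same edge in copy \<open>l\<close>.\<close>

definition copy :: "nat \<Rightarrow> 'a + nat \<Rightarrow> nat set \<times> (nat + ('a + nat))" where
  "copy i v = (if \<exists>t l. v = mid t (2 * l) \<and> 1 \<le> l \<and> l \<le> n \<and> l \<noteq> i
     then ({i, THE l. \<exists>t. v = mid t (2 * l)}, Inl (THE t. \<exists>l. v = mid t (2 * l)))
     else ({i}, Inr v))"

text \<open>The tag tested by \<open>isl\<close> marks the crossing vertices. Vertices of one copy
  share its index, so the edges of the second kind never fall within a copy.\<close>

definition G :: "(nat set \<times> (nat + ('a + nat))) graph" where
  "G = (\<Union>i\<in>{1..n}. copy i ` verts K,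
     {{copy i v, copy i w} | i v w. i \<in> {1..n} \<and> {v, w} \<in> edges K} \<union>
     {{x, y} | x y. x \<in> (\<Union>i\<in>{1..n}. copy i ` verts K) \<and> y \<in> (\<Union>i\<in>{1..n}. copy i ` verts K)
        \<and> fst x \<inter> fst y = {} \<and> \<not> (isl (snd x) \<and> isl (snd y))})"

lemma copy_crossing:
  assumes "1 \<le> l" "l \<le> n" "l \<noteq> i"
  shows "copy i (mid t (2 * l)) = ({i, l}, Inl t)"
proof -
  have "(THE l'. \<exists>t'. mid t (2 * l) = mid t' (2 * l')) = l" by (rule the_equality) auto
  moreover have "(THE t'. \<exists>l'. mid t (2 * l) = mid t' (2 * l')) = t" by (rule the_equality) auto
  ultimately show ?thesis using assms by (auto simp: copy_def)
qed

text \<open>Position \<open>2 * i\<close> of copy \<open>i\<close> itself falls under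
  \<open>unshared\<close>, since a copy does not cross itself.\<close>

lemma copy_cases:
  obtains (crossing) t l where "1 \<le> l" "l \<le> n" "l \<noteq> i" "v = mid t (2 * l)" "copy i v = ({i, l}, Inl t)"
  | (unshared) "copy i v = ({i}, Inr v)"
proof (cases "\<exists>t l. v = mid t (2 * l) \<and> 1 \<le> l \<and> l \<le> n \<and> l \<noteq> i")
  case True
  then obtain t l where "v = mid t (2 * l)" "1 \<le> l" "l \<le> n" "l \<noteq> i" by blast
  then show ?thesis using crossing copy_crossing by blast
next
  case False
  then show ?thesis using unshared by (simp add: copy_def)
qed

lemma copy_inj: "copy i v = copy i w \<longleftrightarrow> v = w"
proof
  assume "copy i v = copy i w"
  then show "v = w"
    by (cases rule: copy_cases[of i v]; cases rule: copy_cases[of i w]) (auto simp: doubleton_eq_iff)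
qed simp

lemma copy_index: "i \<in> fst (copy i v)"
  by (cases rule: copy_cases[of i v]) auto

lemma isl_copyD: "isl (snd (copy i v)) \<Longrightarrow> \<exists>t l. 1 \<le> l \<and> l \<le> n \<and> v = mid t (2 * l)"
  by (cases rule: copy_cases[of i v]) auto

lemma isl_copy_if_other_index: "j \<in> fst (copy i v) \<Longrightarrow> j \<noteq> i \<Longrightarrow> isl (snd (copy i v))"
  by (cases rule: copy_cases[of i v]) auto

lemma verts_G: "verts G = (\<Union>i\<in>{1..n}. copy i ` verts K)"
  by (simp add: G_def verts_def)

lemma edges_G: "edges G =
    {{copy i v, copy i w} | i v w. i \<in> {1..n} \<and> {v, w} \<in> edges K} \<union>
    {{x, y} | x y. x \<in> verts G \<and> y \<in> verts G \<and> fst x \<inter> fst y = {} \<and> \<not> (isl (snd x) \<and> isl (snd y))}"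
  unfolding verts_G by (simp add: G_def edges_def)

lemma edges_G_cases:
  assumes "{x, y} \<in> edges G"
  obtains i v w where "i \<in> {1..n}" "{v, w} \<in> edges K" "x = copy i v" "y = copy i w"
  | "fst x \<inter> fst y = {}" "\<not> (isl (snd x) \<and> isl (snd y))"
proof -
  consider i v w where "i \<in> {1..n}" "{v, w} \<in> edges K" "{x, y} = {copy i v, copy i w}"
    | x' y' where "{x, y} = {x', y'}" "fst x' \<inter> fst y' = {}" "\<not> (isl (snd x') \<and> isl (snd y'))"
    using assms unfolding edges_G by blast
  then show ?thesis
  proof cases
    case (1 i v w)
    then show ?thesis using that(1)[of i v w] that(1)[of i w v]
      by (auto simp: doubleton_eq_iff insert_commute)
  next
    case (2 x' y')
    then show ?thesis using that(2) by (auto simp: doubleton_eq_iff)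
  qed
qed

text \<open>The identification is symmetric: position \<open>2 * i\<close> in copy \<open>j\<close>
  and position \<open>2 * j\<close> in copy \<open>i\<close>, on the same edge \<open>t\<close>,
  both receive the name \<open>({i, j}, Inl t)\<close>.\<close>

lemma mem_copy_if_index:
  assumes "x \<in> verts G" "i \<in> fst x"
  shows "i \<in> {1..n} \<and> x \<in> copy i ` verts K"
proof -
  obtain j v where j: "j \<in> {1..n}" "v \<in> verts K" "x = copy j v" using assms(1) verts_G by auto
  show ?thesis
  proof (cases "j = i")
    case True
    then show ?thesis using j by blast
  next
    case False
    then obtain t where v: "1 \<le> i" "i \<le> n" "v = mid t (2 * i)" "x = ({j, i}, Inl t)"
      using assms(2) j(3) by (cases rule: copy_cases[of j v]) auto
    have "t < q" using j(2) v mid_in_K_iff by blast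
    then have "mid t (2 * j) \<in> verts K" using j(1) unfolding mid_in_K_iff by (simp add: r_def)
    moreover have "copy i (mid t (2 * j)) = x"
      using copy_crossing[of j i t] j(1) False v by (simp add: insert_commute)
    ultimately show ?thesis using v(1,2) by (metis atLeastAtMost_iff image_eqI)
  qed
qed

text \<open>Within a copy, crossing vertices sit at even positions, whose neighbours are at odd
  positions of the same path; the added edges exclude such pairs by definition.\<close>

lemma crossings_independent:
  assumes "isl (snd x)" "isl (snd y)"
  shows "{x, y} \<notin> edges G"
proof
  assume "{x, y} \<in> edges G"
  then obtain i v w where e: "{v, w} \<in> edges K" "x = copy i v" "y = copy i w"
    using assms by (cases rule: edges_G_cases) auto
  obtain t l where v: "1 \<le> l" "l \<le> n" "v = mid t (2 * l)" using isl_copyD assms e by metis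
  obtain t' l' where w: "w = mid t' (2 * l')" using isl_copyD assms e by metis
  have "w = mid t (2 * l - 1) \<or> w = mid t (Suc (2 * l))"
    using mid_nbrD[of t "2 * l" w] e(1) v by (auto simp: pt_def r_def)
  then show False using w v(1) by (auto; presburger)
qed

text \<open>Copies stay induced: the common index \<open>i\<close> rules out added edges, and an
  edge coming from another copy would join two vertices shared by both copies, hence two crossing
  vertices.\<close>

lemma copy_edge_iff:
  assumes "i \<in> {1..n}"
  shows "{copy i v, copy i w} \<in> edges G \<longleftrightarrow> {v, w} \<in> edges K"
proof
  assume e: "{copy i v, copy i w} \<in> edges G"
  then show "{v, w} \<in> edges K"
  proof (cases rule: edges_G_cases)
    case (1 j v' w')
    show ?thesis
    proof (cases "j = i")
      case True
      then show ?thesis using 1 copy_inj by simp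
    next
      case False
      then have "isl (snd (copy i v))" "isl (snd (copy i w))"
        using isl_copy_if_other_index[of j i] copy_index 1 by metis+
      then show ?thesis using crossings_independent e by blast
    qed
  next
    case 2
    then show ?thesis using copy_index by blast
  qed
next
  assume "{v, w} \<in> edges K"
  then show "{copy i v, copy i w} \<in> edges G" using assms unfolding edges_G by blast
qed

lemma wf_G: "wf_graph G"
proof -
  have "e \<subseteq> verts G \<and> card e = 2" if e: "e \<in> edges G" for e
  proof -
    consider i v w where "i \<in> {1..n}" "{v, w} \<in> edges K" "e = {copy i v, copy i w}"
      | x y where "e = {x, y}" "x \<in> verts G" "y \<in> verts G" "fst x \<inter> fst y = {}"
      using e unfolding edges_G by blast
    then show ?thesis
    proof cases
      case (1 i v w)
      then show ?thesis using wf_graph_edge[OF wf_K 1(2)] copy_inj verts_G by auto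
    next
      case (2 x y)
      have "fst x \<noteq> {}" using 2(2) verts_G copy_index by auto
      then have "x \<noteq> y" using 2(4) by blast
      then show ?thesis using 2 by simp
    qed
  qed
  moreover have "finite (verts G)" using wf_K by (simp add: verts_G wf_graph_def)
  ultimately show ?thesis by (simp add: wf_graph_def)
qed

lemma induced_subdivision_copy:
  assumes "i \<in> {1..n}"
  shows "induced_subdivision H G (copy i ` verts K)"
proof -
  let ?f = "inv_into (verts K) (copy i)"
  have "inj_on (copy i) (verts K)" using copy_inj by (auto intro: inj_onI)
  then have "bij_betw ?f (copy i ` verts K) (verts K)"
    by (intro bij_betw_inv_into inj_on_imp_bij_betw)
  moreover have "{x, y} \<in> edges G \<longleftrightarrow> {?f x, ?f y} \<in> edges K"
    if "x \<in> copy i ` verts K" "y \<in> copy i ` verts K" for x y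
    using that copy_edge_iff[OF assms, of "?f x" "?f y"] by (simp add: f_inv_into_f)
  ultimately have "graph_iso (induced_subgraph G (copy i ` verts K)) K"
    unfolding graph_iso_def induced_subgraph_def verts_def edges_def by auto
  then show ?thesis
    using assms subdivision_of_subdiv verts_G unfolding induced_subdivision_def by blast
qed

section \<open>Packing and covering in the glued graph\<close>

text \<open>A common index confines the hole to one copy; pulled back to \<open>K\<close>, it fills
  a whole subdivided edge.\<close>

lemma hole_set_G_contains_run:
  assumes "hole_set G Z"
  obtains i t where "i \<in> {1..n}" "t < q"
    "\<And>j. 1 \<le> j \<Longrightarrow> j \<le> r \<Longrightarrow> copy i (mid t j) \<in> Z"
proof -
  have ZG: "Z \<subseteq> verts G" "Z \<noteq> {}" using hole_setD(1,2)[OF assms] by auto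
  obtain i where i: "\<And>x. x \<in> Z \<Longrightarrow> i \<in> fst x"
  proof (rule hole_set_common_index[OF assms, where I = fst and X = "{x. isl (snd x)}"])
    show "{x, y} \<in> edges G"
      if "x \<in> verts G" "y \<in> verts G" "fst x \<inter> fst y = {}" "x \<notin> {x. isl (snd x)}" for x y
      using that unfolding edges_G by blast
    show "\<exists>i. fst x = {i}" if x: "x \<in> verts G" "x \<notin> {x. isl (snd x)}" for x
    proof -
      obtain j v where "x = copy j v" using x(1) verts_G by auto
      then show ?thesis using x(2) by (cases rule: copy_cases[of j v]) auto
    qed
  qed (use crossings_independent in auto)
  have in_copy: "i \<in> {1..n}" "Z \<subseteq> copy i ` verts K"
    using mem_copy_if_index i ZG by blast+
  have "hole_set K {v \<in> verts K. copy i v \<in> Z}"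
  proof (rule hole_set_bij)
    show "bij_betw (copy i) (verts K) (copy i ` verts K)"
      using copy_inj by (auto simp: bij_betw_def inj_on_def)
    show "{v, w} \<in> edges K \<longleftrightarrow> {copy i v, copy i w} \<in> edges G" for v w
      using copy_edge_iff[OF in_copy(1)] by simp
  qed (use assms in_copy in auto)
  then obtain t where "t < q" "\<And>j. 1 \<le> j \<Longrightarrow> j \<le> r \<Longrightarrow> mid t j \<in> {v \<in> verts K. copy i v \<in> Z}"
    by (rule hole_set_contains_run) blast
  then show ?thesis using that[OF in_copy(1)] by blast
qed

lemma no_disjoint_induced_subdivisions:
  assumes "hole_set H Z0" "\<And>k. k \<le> q \<Longrightarrow> induced_subdivision H G (S k)"
  shows "\<exists>k\<le>q. \<exists>k'\<le>q. k \<noteq> k' \<and> S k \<inter> S k' \<noteq> {}"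
proof -
  have "\<exists>i t. i \<in> {1..n} \<and> t < q \<and> (\<forall>j. 1 \<le> j \<longrightarrow> j \<le> r \<longrightarrow> copy i (mid t j) \<in> S k)"
    if k: "k \<le> q" for k
  proof -
    obtain L where L: "subdivision_of H L" "graph_iso (induced_subgraph G (S k)) L" "S k \<subseteq> verts G"
      using assms(2)[OF k] unfolding induced_subdivision_def by blast
    obtain Y where "hole_set L Y" using hole_set_subdivision[OF L(1) wfH assms(1)] by blast
    then obtain Z where Z: "Z \<subseteq> S k" "hole_set G Z" using hole_set_iso[OF L(2) _ L(3)] by blast
    then show ?thesis using hole_set_G_contains_run[OF Z(2)] by (metis subsetD)
  qed
  then obtain I T where I: "\<And>k. k \<le> q \<Longrightarrow> I k \<in> {1..n}" and T: "\<And>k. k \<le> q \<Longrightarrow> T k < q"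
    and run: "\<And>k j. k \<le> q \<Longrightarrow> 1 \<le> j \<Longrightarrow> j \<le> r \<Longrightarrow> copy (I k) (mid (T k) j) \<in> S k"
    by metis
  have "T ` {..q} \<subseteq> {..<q}" using T by auto
  then have "card (T ` {..q}) \<le> q" using card_mono[of "{..<q}"] by fastforce
  \<comment> \<open>There are \<open>q + 1\<close> runs but only \<open>q\<close> edges of
    \<open>H\<close>.\<close>
  then have "\<not> inj_on T {..q}" by (intro pigeonhole) simp
  then obtain k k' where k: "k \<le> q" "k' \<le> q" "k \<noteq> k'" "T k = T k'" by (auto simp: inj_on_def)
  have "S k \<inter> S k' \<noteq> {}"
  proof (cases "I k = I k'")
    case True
    \<comment> \<open>Both runs fill the same path of the same copy, so its first inner vertex is
      common to them.\<close>
    then have "copy (I k) (mid (T k) 1) \<in> S k \<inter> S k'" using run[of k 1] run[of k' 1] k by (simp add: r_def)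
    then show ?thesis by blast
  next
    case False
    \<comment> \<open>Position \<open>2 * I k'\<close> in copy \<open>I k\<close> and position
      \<open>2 * I k\<close> in copy \<open>I k'\<close> are the same vertex of
      \<open>G\<close>.\<close>
    have "copy (I k) (mid (T k) (2 * I k')) \<in> S k" "copy (I k') (mid (T k) (2 * I k)) \<in> S k'"
      using run[of k "2 * I k'"] run[of k' "2 * I k"] k I[of k] I[of k'] by (auto simp: r_def)
    moreover have "copy (I k) (mid (T k) (2 * I k')) = copy (I k') (mid (T k) (2 * I k))"
      using copy_crossing[of "I k'" "I k" "T k"] copy_crossing[of "I k" "I k'" "T k"] False I k
      by (simp add: insert_commute)
    ultimately show ?thesis by auto
  qed
  then show ?thesis using k by blast
qed

text \<open>A vertex carries at most two indices, so \<open>X\<close> touches at most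
  \<open>2 * card X\<close> copies.\<close>

lemma small_set_misses_copy:
  assumes "X \<subseteq> verts G" "2 * card X < n"
  shows "\<exists>i\<in>{1..n}. copy i ` verts K \<inter> X = {}"
proof -
  have fin: "finite X" using assms(1) wf_G finite_subset by (auto simp: wf_graph_def)
  have "card (fst x) \<le> 2" if "x \<in> verts G" for x
  proof -
    obtain i v where "x = copy i v" using \<open>x \<in> verts G\<close> verts_G by auto
    then show ?thesis by (cases rule: copy_cases[of i v]) auto
  qed
  then have "card (\<Union>x\<in>X. fst x) \<le> (\<Sum>x\<in>X. 2)"
    using assms(1) by (intro order.trans[OF card_UN_le[OF fin]] sum_mono) auto
  then have "card (\<Union>x\<in>X. fst x) < card {1..n}" using assms(2) by simp
  moreover have "finite (\<Union>x\<in>X. fst x)"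
  proof -
    have "fst x \<subseteq> {1..n}" if "x \<in> X" for x using mem_copy_if_index assms(1) that by blast
    then show ?thesis using fin finite_subset by fastforce
  qed
  ultimately obtain i where "i \<in> {1..n}" "i \<notin> (\<Union>x\<in>X. fst x)"
    by (metis card_mono not_le subsetI)
  then show ?thesis using copy_index by blast
qed

end

section \<open>Choice of the parameters\<close>

theorem mainTheorem4:
  fixes H :: "'a graph"
  assumes "wf_graph H"
    and "\<exists>n\<ge>5. has_induced_cycle_of_length H n"
  shows "\<not> induced_EP_property H"
proof -
  obtain l S where l: "5 \<le> l" "S \<subseteq> verts H" "graph_iso (induced_subgraph H S) (cycle_graph l)"
    using assms(2) unfolding has_induced_cycle_of_length_def by blast
  obtain Z where Z: "hole_set H Z"
    using hole_set_iso[OF l(3) hole_set_cycle_graph[OF l(1)] l(2)] by blast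
  have "edges H \<subseteq> Pow (verts H)" using assms(1) by (auto simp: wf_graph_def)
  then have "finite (edges H)" using assms(1) by (meson finite_Pow_iff finite_subset wf_graph_def)
  then obtain q and e :: "nat \<Rightarrow> 'a set" where e: "edges H = e ` {..<q}" "inj_on e {..<q}"
    using finite_imp_nat_seg_image_inj_on[of "edges H"] by (auto simp: lessThan_def)
  have "\<exists>x y. t < q \<longrightarrow> e t = {x, y}" for t
  proof (cases "t < q")
    case True
    then have "card (e t) = 2" using assms(1) e(1) by (simp add: wf_graph_def)
    then show ?thesis by (auto simp: card_2_iff)
  qed simp
  then obtain a b where ab: "\<And>t. t < q \<Longrightarrow> e t = {a t, b t}" by metis
  interpret edge_enumeration H a b q
  proof
    show "inj_on (\<lambda>t. {a t, b t}) {..<q}" using e(2) ab by (simp add: inj_on_def)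
    show "edges H = (\<lambda>t. {a t, b t}) ` {..<q}" unfolding e(1) using ab by (intro image_cong) auto
  qed (fact assms(1))
  show ?thesis
  \<comment> \<open>The packing number \<open>Suc q\<close> depends on \<open>H\<close> alone, while
    the number of copies grows with \<open>N\<close>.\<close>
  proof (rule not_induced_EP_propertyI[of "Suc q"])
    fix N :: nat
    \<comment> \<open>With \<open>2 * N + 1\<close> copies, any \<open>N\<close> vertices leave at
      least one copy untouched.\<close>
    interpret crossing_copies H a b q "2 * N + 1" ..
    have "\<not> (\<exists>S. (\<forall>i<Suc q. induced_subdivision H G (S i))
             \<and> (\<forall>i<Suc q. \<forall>j<Suc q. i \<noteq> j \<longrightarrow> S i \<inter> S j = {}))"
      using no_disjoint_induced_subdivisions[OF Z] unfolding less_Suc_eq_le by metis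
    moreover have "\<exists>S. induced_subdivision H G S \<and> S \<inter> X = {}" if "X \<subseteq> verts G" "card X \<le> N" for X
      using small_set_misses_copy[of X] induced_subdivision_copy that by fastforce
    ultimately show "\<exists>G :: (nat set \<times> (nat + ('a + nat))) graph. wf_graph G
      \<and> \<not> (\<exists>S. (\<forall>i<Suc q. induced_subdivision H G (S i))
             \<and> (\<forall>i<Suc q. \<forall>j<Suc q. i \<noteq> j \<longrightarrow> S i \<inter> S j = {}))
      \<and> (\<forall>X\<subseteq>verts G. card X \<le> N \<longrightarrow> (\<exists>S. induced_subdivision H G S \<and> S \<inter> X = {}))"
      using wf_G by blast
  qed simp
qed

end
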